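(* Let $\mathcal{V}$ be a finite vocabulary and $\mathcal{M} = \{1,\dots,M\}$ a set of workers with weights $w_i \ge 0$, $\sum_{i\in\mathcal{M}} w_i = 1$. At decoding step $t$, let $\mathbf{p}_{t,i} = [p_{t,i}(x)]_{x\in\mathcal{V}}$ be the probability distribution on $\mathcal{V}$ produced by worker $i$, let $\mathbf{k} = [k_1,\dots,k_M]$ with $1\le k_i<|\mathcal{V}|$, let $\mathcal{V}^{(k_i)}\subset\mathcal{V}$ be a set of $k_i$ tokens with the highest probabilities under $\mathbf{p}_{t,i}$, and let $\epsilon_{t,i}^{(k_i)} = \sum_{v\notin\mathcal{V}^{(k_i)}} p_{t,i}(v)$. Let $\mathbf{p}^{(k_i)}_{t,i}$ be the reconstructed distribution of worker $i$ under either of the two reconstruction schemes (renormalized top-$K$ reconstruction or residual-mass redistribution), and put $\bar{\mathbf{p}}_t = \sum_{i\in\mathcal{M}} w_i \mathbf{p}_{t,i}$ and $\bar{\mathbf{p}}^{(\mathbf{k})}_t = \sum_{i\in\mathcal{M}} w_i \mathbf{p}^{(k_i)}_{t,i}$. Then the aggregation bias $\Delta^{(\mathbf{k})}_t = \|\bar{\mathbf{p}}^{(\mathbf{k})}_t - \bar{\mathbf{p}}_t\|_1$ satisfies $$\Delta^{(\mathbf{k})}_t \le 2\sum_{i\in\mathcal{M}} w_i\, \epsilon_{t,i}^{(k_i)}.$$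
   Context: $\|\cdot\|_1$ is the $\ell_1$ norm on $\mathbb{R}^{|\mathcal{V}|}$. For each worker $i$, the set $\mathcal{V}^{(k_i)}$ (which depends on $\mathbf{p}_{t,i}$) consists of $k_i$ tokens of largest probability under $\mathbf{p}_{t,i}$ (ties broken arbitrarily), i.e. $|\mathcal{V}^{(k_i)}| = k_i$ and $p_{t,i}(x) \ge p_{t,i}(y)$ for all $x\in\mathcal{V}^{(k_i)}$, $y\notin\mathcal{V}^{(k_i)}$. The retained mass is $\rho_{t,i} = \sum_{v\in\mathcal{V}^{(k_i)}} p_{t,i}(v)$ and the residual mass is $\epsilon_{t,i} = \epsilon_{t,i}^{(k_i)} = \sum_{v\notin\mathcal{V}^{(k_i)}} p_{t,i}(v) = 1-\rho_{t,i}$. Renormalized top-$K$ reconstruction: $p^{(k_i)}_{t,i}(x) = p_{t,i}(x)/\rho_{t,i}$ for $x\in\mathcal{V}^{(k_i)}$, and $p^{(k_i)}_{t,i}(x) = 0$ for $x\notin\mathcal{V}^{(k_i)}$. Residual-mass redistribution: $p^{(k_i)}_{t,i}(x) = p_{t,i}(x)$ for $x\in\mathcal{V}^{(k_i)}$, and $p^{(k_i)}_{t,i}(x) = \dfrac{\epsilon_{t,i}}{|\mathcal{V}|-k_i}$ for $x\notin\mathcal{V}^{(k_i)}$. *)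

theory Defs
  imports "HOL-Analysis.Analysis"
begin

text \<open>The vocabulary is the finite type \<open>'v\<close>; a distribution on it is a vector in \<open>real ^ 'v\<close>.\<close>

definition l1_norm :: "real ^ 'v \<Rightarrow> real" where
  "l1_norm x = (\<Sum>v\<in>UNIV. \<bar>x $ v\<bar>)"

definition prob_vector :: "real ^ 'v \<Rightarrow> bool" where
  "prob_vector p \<longleftrightarrow> (\<forall>v. 0 \<le> p $ v) \<and> (\<Sum>v\<in>UNIV. p $ v) = 1"

text \<open>Ties may make the top-\<open>k\<close> set non-unique, hence a predicate rather than a function.\<close>

definition is_top_set :: "nat \<Rightarrow> real ^ 'v \<Rightarrow> 'v set \<Rightarrow> bool" where
  "is_top_set k p S \<longleftrightarrow> card S = k \<and> (\<forall>x\<in>S. \<forall>y. y \<notin> S \<longrightarrow> p $ x \<ge> p $ y)"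

definition retained_mass :: "real ^ 'v \<Rightarrow> 'v set \<Rightarrow> real" where
  "retained_mass p S = (\<Sum>v\<in>S. p $ v)"

definition residual_mass :: "real ^ 'v \<Rightarrow> 'v set \<Rightarrow> real" where
  "residual_mass p S = (\<Sum>v\<in>-S. p $ v)"

definition renormalized_top :: "real ^ 'v \<Rightarrow> 'v set \<Rightarrow> real ^ 'v" where
  "renormalized_top p S = (\<chi> x. if x \<in> S then p $ x / retained_mass p S else 0)"

definition residual_redistribution :: "nat \<Rightarrow> real ^ 'v \<Rightarrow> 'v set \<Rightarrow> real ^ 'v" where
  "residual_redistribution k p S =
     (\<chi> x. if x \<in> S then p $ x else residual_mass p S / (real CARD('v) - real k))"

definition aggregate :: "nat \<Rightarrow> (nat \<Rightarrow> real) \<Rightarrow> (nat \<Rightarrow> real ^ 'v) \<Rightarrow> real ^ 'v" where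
  "aggregate M w p = (\<Sum>i\<in>{1..M}. w i *\<^sub>R p i)"

definition aggregation_bias ::
  "nat \<Rightarrow> (nat \<Rightarrow> real) \<Rightarrow> (nat \<Rightarrow> real ^ 'v) \<Rightarrow> (nat \<Rightarrow> real ^ 'v) \<Rightarrow> real" where
  "aggregation_bias M w q p = l1_norm (aggregate M w q - aggregate M w p)"

end

theory Submission
  imports Defs
begin

text \<open>The aggregation bias is the l1 norm of a nonnegative combination of the per-worker
  errors, so by the triangle inequality it suffices to bound each worker's error by twice its
  residual mass \<epsilon>. Renormalization moves the mass \<epsilon> from the discarded tokens to
  the retained ones: each side contributes exactly \<epsilon>
  (\<open>l1_norm_renormalized_top_diff\<close>). Redistribution changes only the discarded tokens,
  where the old and new values are nonnegative and both sum to \<epsilon>, so they differ by at most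
  2\<epsilon> (\<open>l1_norm_residual_redistribution_diff_le\<close>).\<close>

lemma l1_norm_triangle: "l1_norm (x + y) \<le> l1_norm x + l1_norm y"
  by (simp add: l1_norm_def sum.distrib[symmetric] sum_mono)

lemma l1_norm_scaleR: "l1_norm (c *\<^sub>R x) = \<bar>c\<bar> * l1_norm x"
  by (simp add: l1_norm_def abs_mult sum_distrib_left)

lemma l1_norm_sum_le: "l1_norm (\<Sum>i\<in>A. f i) \<le> (\<Sum>i\<in>A. l1_norm (f i))"
proof (induction A rule: infinite_finite_induct)
  case (insert a A)
  then show ?case
    using l1_norm_triangle[of "f a" "\<Sum>i\<in>A. f i"] by simp
qed (simp_all add: l1_norm_def)

lemma sum_UNIV_split: "(\<Sum>v\<in>UNIV. f v) = (\<Sum>v\<in>S. f v) + (\<Sum>v\<in>-S. f v)"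
  for S :: "'a::finite set" and f :: "'a \<Rightarrow> real"
  using sum.subset_diff[of S UNIV f] by (simp add: Compl_eq_Diff_UNIV add.commute)

lemma l1_norm_split: "l1_norm x = (\<Sum>v\<in>S. \<bar>x $ v\<bar>) + (\<Sum>v\<in>-S. \<bar>x $ v\<bar>)"
  unfolding l1_norm_def by (rule sum_UNIV_split)

lemma retained_plus_residual:
  "prob_vector p \<Longrightarrow> retained_mass p S + residual_mass p S = 1"
  unfolding prob_vector_def retained_mass_def residual_mass_def
  by (simp add: sum_UNIV_split[symmetric])

text \<open>This makes the division in \<open>renormalized_top\<close> legitimate. Here the
  maximality of the top set enters: if its tokens had probability zero, so would all others,
  contradicting total mass 1.\<close>

lemma retained_mass_pos:
  assumes p: "prob_vector p" and top: "is_top_set k p S" and k: "1 \<le> k"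
  shows "0 < retained_mass p S"
proof (rule ccontr)
  assume "\<not> 0 < retained_mass p S"
  moreover have nonneg: "0 \<le> p $ v" for v
    using p by (simp add: prob_vector_def)
  ultimately have "retained_mass p S = 0"
    unfolding retained_mass_def by (meson sum_nonneg order_antisym_conv not_less)
  then have zero: "p $ v = 0" if "v \<in> S" for v
    using that nonneg unfolding retained_mass_def by (simp add: sum_nonneg_eq_0_iff)
  \<comment> \<open>\<open>S\<close> is nonempty because \<open>k\<close> is at least 1; the zero
    probability of \<open>x\<close> then dominates every token outside \<open>S\<close>.\<close>
  obtain x where x: "x \<in> S"
    using top k unfolding is_top_set_def by fastforce
  have "p $ v = 0" for v
  proof (cases "v \<in> S")
    case False
    then have "p $ v \<le> p $ x"
      using top x unfolding is_top_set_def by blast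
    with zero[OF x] nonneg[of v] show ?thesis by simp
  qed (rule zero)
  with p show False
    by (simp add: prob_vector_def)
qed

lemma l1_norm_renormalized_top_diff:
  assumes p: "prob_vector p" and pos: "0 < retained_mass p S"
  shows "l1_norm (renormalized_top p S - p) = 2 * residual_mass p S"
proof -
  let ?r = "retained_mass p S"
  have nonneg: "0 \<le> p $ v" for v
    using p by (simp add: prob_vector_def)
  have sum1: "?r + residual_mass p S = 1"
    using p by (rule retained_plus_residual)
  have "0 \<le> residual_mass p S"
    unfolding residual_mass_def by (intro sum_nonneg nonneg)
  \<comment> \<open>Renormalizing can only increase a retained probability, which fixes the sign
    inside the absolute value.\<close>
  then have "1 \<le> 1 / ?r"
    using pos sum1 by simp
  then have "\<bar>p $ v / ?r - p $ v\<bar> = p $ v * (1 / ?r - 1)" for v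
    using mult_nonneg_nonneg[OF nonneg[of v], of "1 / ?r - 1"]
    by (simp add: right_diff_distrib)
  then have "(\<Sum>v\<in>S. \<bar>(renormalized_top p S - p) $ v\<bar>) = ?r * (1 / ?r - 1)"
    by (simp add: renormalized_top_def retained_mass_def sum_distrib_right)
  also have "\<dots> = residual_mass p S"
    using pos sum1 by (simp add: right_diff_distrib)
  finally have inside: "(\<Sum>v\<in>S. \<bar>(renormalized_top p S - p) $ v\<bar>) = residual_mass p S" .
  have "(\<Sum>v\<in>-S. \<bar>(renormalized_top p S - p) $ v\<bar>) = residual_mass p S"
    using nonneg by (simp add: renormalized_top_def residual_mass_def)
  with inside show ?thesis
    by (simp add: l1_norm_split[of _ S])
qed

lemma l1_norm_residual_redistribution_diff_le:
  fixes p :: "real ^ 'v"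
  assumes p: "prob_vector p" and card: "card S = k" and k: "k < CARD('v)"
  shows "l1_norm (residual_redistribution k p S - p) \<le> 2 * residual_mass p S"
proof -
  let ?c = "residual_mass p S / (real CARD('v) - real k)"
  have nonneg: "0 \<le> p $ v" for v
    using p by (simp add: prob_vector_def)
  have c: "0 \<le> ?c"
    using k unfolding residual_mass_def by (intro divide_nonneg_nonneg sum_nonneg nonneg) simp
  have card_Compl: "real (card (- S)) = real CARD('v) - real k"
    using card k by (simp add: Compl_eq_Diff_UNIV card_Diff_subset of_nat_diff)
  \<comment> \<open>Both terms are nonnegative, so bounding the difference by the sum counts the
    residual mass twice: once as spread uniformly by \<open>?c\<close>, once as distributed by
    \<open>p\<close>.\<close>
  have "(\<Sum>v\<in>-S. \<bar>?c - p $ v\<bar>) \<le> (\<Sum>v\<in>-S. ?c + p $ v)"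
  proof (rule sum_mono)
    fix v
    show "\<bar>?c - p $ v\<bar> \<le> ?c + p $ v"
      using c nonneg[of v] by linarith
  qed
  also have "\<dots> = real (card (- S)) * ?c + residual_mass p S"
    by (simp add: sum.distrib residual_mass_def)
  \<comment> \<open>The number of discarded tokens cancels the denominator of \<open>?c\<close>,
    which is nonzero since \<open>k\<close> is less than the vocabulary size.\<close>
  also have "\<dots> = 2 * residual_mass p S"
    using k by (simp add: card_Compl)
  finally show ?thesis
    by (simp add: l1_norm_split[of _ S] residual_redistribution_def)
qed

theorem theorem2:
  fixes M t :: nat
    and w :: "nat \<Rightarrow> real"
    and k :: "nat \<Rightarrow> nat"
    and p q :: "nat \<Rightarrow> nat \<Rightarrow> real ^ 'v"
    and V :: "nat \<Rightarrow> nat \<Rightarrow> 'v set"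
  assumes w_nonneg: "\<And>i. i \<in> {1..M} \<Longrightarrow> 0 \<le> w i"
    and w_sum: "(\<Sum>i\<in>{1..M}. w i) = 1"
    and p_prob: "\<And>i. i \<in> {1..M} \<Longrightarrow> prob_vector (p t i)"
    and k_range: "\<And>i. i \<in> {1..M} \<Longrightarrow> 1 \<le> k i \<and> k i < CARD('v)"
    and V_top: "\<And>i. i \<in> {1..M} \<Longrightarrow> is_top_set (k i) (p t i) (V t i)"
    and q_scheme: "\<And>i. i \<in> {1..M} \<Longrightarrow>
           q t i = renormalized_top (p t i) (V t i) \<or>
           q t i = residual_redistribution (k i) (p t i) (V t i)"
  shows "aggregation_bias M w (q t) (p t) \<le> 2 * (\<Sum>i\<in>{1..M}. w i * residual_mass (p t i) (V t i))"
proof -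
  have worker: "l1_norm (q t i - p t i) \<le> 2 * residual_mass (p t i) (V t i)"
    if i: "i \<in> {1..M}" for i
    using q_scheme[OF i]
  proof
    assume "q t i = renormalized_top (p t i) (V t i)"
    then show ?thesis
      using l1_norm_renormalized_top_diff[OF p_prob[OF i] retained_mass_pos[OF p_prob[OF i] V_top[OF i]]]
        k_range[OF i] by simp
  next
    assume "q t i = residual_redistribution (k i) (p t i) (V t i)"
    then show ?thesis
      using l1_norm_residual_redistribution_diff_le[OF p_prob[OF i], of "V t i" "k i"]
        V_top[OF i] k_range[OF i] by (simp add: is_top_set_def)
  qed
  \<comment> \<open>Both aggregates carry the same weights, so the difference passes inside the sum,
    even when workers use different schemes.\<close>
  have "aggregation_bias M w (q t) (p t) = l1_norm (\<Sum>i\<in>{1..M}. w i *\<^sub>R (q t i - p t i))"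
    by (simp add: aggregation_bias_def aggregate_def scaleR_diff_right sum_subtractf)
  also have "\<dots> \<le> (\<Sum>i\<in>{1..M}. l1_norm (w i *\<^sub>R (q t i - p t i)))"
    by (rule l1_norm_sum_le)
  also have "\<dots> = (\<Sum>i\<in>{1..M}. w i * l1_norm (q t i - p t i))"
    by (intro sum.cong refl) (simp add: l1_norm_scaleR w_nonneg)
  also have "\<dots> \<le> (\<Sum>i\<in>{1..M}. w i * (2 * residual_mass (p t i) (V t i)))"
    by (intro sum_mono mult_left_mono worker w_nonneg)
  also have "\<dots> = 2 * (\<Sum>i\<in>{1..M}. w i * residual_mass (p t i) (V t i))"
    by (simp add: sum_distrib_left mult_ac)
  finally show ?thesis .
qed

end
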